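(* Let $f:\mathbb{R}^2\to\mathbb{R}^2$, $f(x,y)=(g(x,y),h(x,y))$, be a homeomorphism of the plane with $f(0,0)=(0,0)$, and let $K\subset\mathbb{R}^2$ be compact. Assume that for any $\Delta_0>0$ there exist $\delta,\Delta>0$ with $\delta<\Delta<\Delta_0$ such that for every $p=(p_x,p_y)\in K$ the following hold: (i) $f(P(\delta,p))\subset \mathrm{Int}^0 P(\Delta,f(p))$ and $f^{-1}(P(\delta,f(p)))\subset \mathrm{Int}^0 P(\Delta,p)$; (ii) $|g(p_x+v,p_y+w)-g(p_x,p_y)|<\delta$ for all $(v,w)\in H(\delta)$, where $$H(\delta)=\{(v,w):\ |v|\leq\delta,\ w=0\}\cup\{(v,w):\ |v|=\delta,\ |w|\leq\delta\};$$ (iii) $|h(p_x+v,p_y)-h(p_x,p_y)|<\delta$ for all $v$ with $0\leq|v|\leq\Delta$; (iv) $|h(p_x+v,p_y+w)-h(p_x,p_y)|>\delta$ for all $(v,w)$ with $0\leq|v|\leq\delta$ and $|w|=\delta$. Then $f$ has the finite shadowing property in the set $K$.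
   Context: For a point $p=(p_x,p_y)\in\mathbb{R}^2$ and $\delta>0$, $$P(\delta,p)=\{q\in\mathbb{R}^2:\ |q_y-p_y|\leq\delta,\ |q_x-p_x|\leq\delta\},$$ $$\mathrm{Int}^0P(\delta,p)=\{q\in\mathbb{R}^2:\ |q_y-p_y|<\delta,\ |q_x-p_x|<\delta\}.$$ Below $|\cdot|$ on $\mathbb{R}^2$ is the Euclidean norm. Finite $d$-pseudotrajectory: for $d>0$, a finite set of points $\{p_k:\ 0\leq k\leq m\}$ such that $|f(p_k)-p_{k+1}|\leq d$ for $0\leq k\leq m-1$. Finite shadowing property in a set $K$: for any $\varepsilon>0$ there exists $d>0$ (depending on $K$ and $\varepsilon$ but not on $m$) such that, for every $m$ and every $d$-pseudotrajectory $\{p_k:\ 0\leq k\leq m\}$ of $f$ with all $p_k\in K$, there exists a point $r\in\mathbb{R}^2$ such that $|f^k(r)-p_k|\leq\varepsilon$ for $0\leq k\leq m$. *)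

theory Defs
  imports "HOL-Analysis.Analysis"
begin

text \<open>
  The plane is \<^typ>\<open>real \<times> real\<close>, whose library norm is the Euclidean one. The squares below are
  balls of the maximum norm and therefore not instances of \<^const>\<open>cball\<close> and \<^const>\<open>ball\<close>.
\<close>

definition square :: "real \<Rightarrow> real \<times> real \<Rightarrow> (real \<times> real) set" where
  "square \<delta> p = {q. \<bar>snd q - snd p\<bar> \<le> \<delta> \<and> \<bar>fst q - fst p\<bar> \<le> \<delta>}"

definition open_square :: "real \<Rightarrow> real \<times> real \<Rightarrow> (real \<times> real) set" where
  "open_square \<delta> p = {q. \<bar>snd q - snd p\<bar> < \<delta> \<and> \<bar>fst q - fst p\<bar> < \<delta>}"

definition H_set :: "real \<Rightarrow> (real \<times> real) set" where
  "H_set \<delta> = {(v, w). \<bar>v\<bar> \<le> \<delta> \<and> w = 0} \<union> {(v, w). \<bar>v\<bar> = \<delta> \<and> \<bar>w\<bar> \<le> \<delta>}"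

text \<open>
  A finite sequence with indices \<open>0, \<dots>, m\<close> is a function on \<^typ>\<open>nat\<close> of which only the values at
  indices up to \<open>m\<close> are used.
\<close>

definition finite_pseudotrajectory ::
    "(real \<times> real \<Rightarrow> real \<times> real) \<Rightarrow> real \<Rightarrow> nat \<Rightarrow> (nat \<Rightarrow> real \<times> real) \<Rightarrow> bool" where
  "finite_pseudotrajectory f d m p \<longleftrightarrow> (\<forall>k<m. norm (f (p k) - p (Suc k)) \<le> d)"

definition finite_shadowing :: "(real \<times> real \<Rightarrow> real \<times> real) \<Rightarrow> (real \<times> real) set \<Rightarrow> bool" where
  "finite_shadowing f K \<longleftrightarrow>
    (\<forall>\<epsilon>>0. \<exists>d>0. \<forall>m p.
      finite_pseudotrajectory f d m p \<and> (\<forall>k\<le>m. p k \<in> K) \<longrightarrow>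
      (\<exists>r. \<forall>k\<le>m. norm ((f ^^ k) r - p k) \<le> \<epsilon>))"

end

theory Submission
  imports Defs
begin

text \<open>
  Write \<open>S\<close> for the square around \<open>p\<close> and \<open>S'\<close> for the square around \<open>c\<close>, a point close to \<open>f p\<close>.
  The map sends \<open>S\<close> across \<open>S'\<close> in the vertical direction: the part of \<open>f ` S\<close> at the height of \<open>S'\<close>
  lies in \<open>S'\<close>, since the two half-strips left and right of \<open>S'\<close> are connected, unbounded, and
  avoid the image of the boundary of \<open>S\<close>; and one of the horizontal edges of \<open>S\<close> is sent above \<open>S'\<close>
  and the other one below. The image of \<open>S\<close> cannot fold back because the preimage of each horizontal
  edge of \<open>S'\<close> is a connected subset of the square of size \<open>\<Delta>\<close> around \<open>p\<close> that avoids its horizontal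
  axis, so it lies on one side of the axis.

  Consequently, a curve that crosses \<open>S\<close> from bottom to top is sent to a curve with a piece that
  crosses \<open>S'\<close>. For a pseudotrajectory, start with the vertical segment through the first point
  and pass to such a piece at every step; any point of the last piece shadows.
\<close>

text \<open>The centre \<open>c\<close> is a separate parameter because the next point of a
  pseudotrajectory is only close to \<open>f p\<close>. The strict inequalities keep the condition
  stable when \<open>c\<close> moves. The orientation is chosen per pair \<open>v\<close>,
  \<open>v'\<close>, which makes both clauses pointwise over compact sets and suffices for the two
  endpoints of a curve.\<close>

definition covers :: "(real \<times> real \<Rightarrow> real \<times> real) \<Rightarrow> real \<Rightarrow> real \<times> real \<Rightarrow> real \<times> real \<Rightarrow> bool" where
  "covers f \<delta> p c \<longleftrightarrow>
    (\<forall>q\<in>square \<delta> p. \<bar>snd (f q) - snd c\<bar> \<le> \<delta> \<longrightarrow> \<bar>fst (f q) - fst c\<bar> < \<delta>) \<and>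
    (\<forall>v\<in>{-\<delta>..\<delta>}. \<forall>v'\<in>{-\<delta>..\<delta>}.
      snd (f (p + (v, \<delta>))) - snd c > \<delta> \<and> snd (f (p + (v', -\<delta>))) - snd c < -\<delta> \<or>
      snd (f (p + (v, \<delta>))) - snd c < -\<delta> \<and> snd (f (p + (v', -\<delta>))) - snd c > \<delta>)"

section \<open>Crossings of a band by a continuous function on an interval\<close>

text \<open>Take \<open>b'\<close> as the first time at height \<open>\<beta>\<close> and
  \<open>a'\<close> as the last time before it at height \<open>\<alpha>\<close>. By the
  intermediate value theorem, leaving the band in between would give an earlier \<open>b'\<close> or
  a later \<open>a'\<close>.\<close>

lemma crossing_subinterval_increasing:
  fixes u :: "real \<Rightarrow> real"
  assumes "a \<le> b" "continuous_on {a..b} u" "u a \<le> \<alpha>" "\<alpha> \<le> \<beta>" "\<beta> \<le> u b"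
  obtains a' b' where "a \<le> a'" "a' \<le> b'" "b' \<le> b" "u a' = \<alpha>" "u b' = \<beta>"
    "u ` {a'..b'} \<subseteq> {\<alpha>..\<beta>}"
proof -
  have level: "compact {t \<in> {r..s}. u t = y}" if "a \<le> r" "s \<le> b" for r s y
  proof -
    have "continuous_on {r..s} u"
      using assms(2) by (rule continuous_on_subset) (use that in auto)
    then have "closed {t \<in> {r..s}. u t = y}"
      by (rule continuous_closed_preimage_constant) simp
    then have "compact ({r..s} \<inter> {t \<in> {r..s}. u t = y})"
      by (rule compact_Int_closed[OF compact_Icc])
    also have "{r..s} \<inter> {t \<in> {r..s}. u t = y} = {t \<in> {r..s}. u t = y}"
      by blast
    finally show ?thesis .
  qed
  have ivt: "\<exists>t\<in>{r..s}. u t = y" if "a \<le> r" "r \<le> s" "s \<le> b" "u r \<le> y" "y \<le> u s" for r s y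
  proof -
    have "continuous_on {r..s} u"
      using assms(2) by (rule continuous_on_subset) (use that in auto)
    then show ?thesis
      using IVT'[of u r y s] that by auto
  qed
  obtain b' where b': "b' \<in> {a..b}" "u b' = \<beta>" "\<And>t. t \<in> {a..b} \<Longrightarrow> u t = \<beta> \<Longrightarrow> b' \<le> t"
  proof -
    have "{t \<in> {a..b}. u t = \<beta>} \<noteq> {}"
      using ivt[of a b \<beta>] assms by auto
    from compact_attains_inf[OF level this] show thesis
      using that by auto
  qed
  obtain a' where a': "a' \<in> {a..b'}" "u a' = \<alpha>" "\<And>t. t \<in> {a..b'} \<Longrightarrow> u t = \<alpha> \<Longrightarrow> t \<le> a'"
  proof -
    have "{t \<in> {a..b'}. u t = \<alpha>} \<noteq> {}"
      using ivt[of a b' \<alpha>] assms b' by auto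
    from compact_attains_sup[OF level this] show thesis
      using that b'(1) by auto
  qed
  have "u t \<in> {\<alpha>..\<beta>}" if t: "t \<in> {a'..b'}" for t
  proof (rule ccontr)
    assume "u t \<notin> {\<alpha>..\<beta>}"
    then consider "u t < \<alpha>" | "u t > \<beta>" by fastforce
    then show False
    proof cases
      case 1
      then obtain s where "s \<in> {t..b'}" "u s = \<alpha>"
        using ivt[of t b' \<alpha>] t a'(1) b'(1,2) assms(4) by auto
      moreover from this have "s \<le> a'"
        using a'(3)[of s] t a'(1) by auto
      ultimately have "s = t"
        using t by auto
      with \<open>u s = \<alpha>\<close> 1 show False by simp
    next
      case 2
      then obtain s where "s \<in> {a'..t}" "u s = \<beta>"
        using ivt[of a' t \<beta>] t a'(1,2) b'(1) assms(4) by auto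
      moreover from this have "b' \<le> s"
        using b'(3)[of s] t a'(1) b'(1) by auto
      ultimately have "s = t"
        using t by auto
      with \<open>u s = \<beta>\<close> 2 show False by simp
    qed
  qed
  with a' b' show thesis
    by (intro that[of a' b']) auto
qed

text \<open>The band is symmetric, so passing to \<open>- u\<close> reduces the decreasing case to
  the increasing one. Both cases occur because \<open>f\<close> may turn a square upside
  down.\<close>

lemma crossing_subinterval:
  fixes u :: "real \<Rightarrow> real"
  assumes ab: "a \<le> b" and cont: "continuous_on {a..b} u" and "\<delta> > 0"
    and ends: "u a > \<delta> \<and> u b < -\<delta> \<or> u a < -\<delta> \<and> u b > \<delta>"
  obtains a' b' where "a \<le> a'" "a' \<le> b'" "b' \<le> b"
    "u a' = \<delta> \<and> u b' = -\<delta> \<or> u a' = -\<delta> \<and> u b' = \<delta>"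
    "\<And>t. t \<in> {a'..b'} \<Longrightarrow> \<bar>u t\<bar> \<le> \<delta>"
  using ends
proof
  assume "u a < -\<delta> \<and> u b > \<delta>"
  then obtain a' b' where "a \<le> a'" "a' \<le> b'" "b' \<le> b" "u a' = -\<delta>" "u b' = \<delta>"
      "u ` {a'..b'} \<subseteq> {-\<delta>..\<delta>}"
    using crossing_subinterval_increasing[OF ab cont, of "-\<delta>" \<delta>] \<open>\<delta> > 0\<close> by auto
  then show thesis
    by (intro that[of a' b']) (auto simp: abs_le_iff image_subset_iff minus_le_iff)
next
  assume "u a > \<delta> \<and> u b < -\<delta>"
  moreover have "continuous_on {a..b} (\<lambda>t. - u t)"
    using cont by (intro continuous_intros)
  ultimately obtain a' b' where "a \<le> a'" "a' \<le> b'" "b' \<le> b" "- u a' = -\<delta>" "- u b' = \<delta>"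
      "(\<lambda>t. - u t) ` {a'..b'} \<subseteq> {-\<delta>..\<delta>}"
    using crossing_subinterval_increasing[OF ab, of "\<lambda>t. - u t" "-\<delta>" \<delta>] \<open>\<delta> > 0\<close> by auto
  then show thesis
    by (intro that[of a' b']) (auto simp: abs_le_iff image_subset_iff minus_le_iff)
qed

section \<open>Orbits along a chain of covering squares\<close>

lemma orbit_through_squares:
  assumes "\<delta> > 0" and cont: "continuous_on UNIV f"
    and cov: "\<And>k. k < m \<Longrightarrow> covers f \<delta> (p k) (p (Suc k))"
  shows "\<exists>r. \<forall>k\<le>m. (f ^^ k) r \<in> square \<delta> (p k)"
proof -
  \<comment> \<open>All curves are parametrised by the height \<open>t\<close> on the initial
    vertical line, so passing to a piece of a curve means shrinking an interval of
    parameters.\<close>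
  define \<phi> where "\<phi> k t = (f ^^ k) (p 0 + (0, t))" for k t
  define u where "u k t = snd (\<phi> k t) - snd (p k)" for k t
  have "continuous_on UNIV (f ^^ k)" for k
  proof (induction k)
    case (Suc k)
    then show ?case
      using continuous_on_compose[OF Suc continuous_on_subset[OF cont]] by (simp add: o_def)
  qed simp
  then have "continuous_on A (\<phi> k)" for A k
    unfolding \<phi>_def by (rule continuous_on_compose2) (auto intro!: continuous_intros)
  then have cont_u: "continuous_on A (u k)" for A k
    unfolding u_def by (intro continuous_intros)
  \<comment> \<open>The invariant puts the endpoints exactly on opposite horizontal edges of the
    square around \<open>p k\<close>, where the second clause of \<open>covers\<close> applies. All
    earlier squares are carried along because the interval only shrinks.\<close>
  have "\<exists>a b. a \<le> b \<and> (u k a = \<delta> \<and> u k b = -\<delta> \<or> u k a = -\<delta> \<and> u k b = \<delta>) \<and>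
      (\<forall>t\<in>{a..b}. \<forall>j\<le>k. \<phi> j t \<in> square \<delta> (p j))" if "k \<le> m" for k
    using that
  proof (induction k)
    case 0
    show ?case
      using \<open>\<delta> > 0\<close>
      by (intro exI[of _ "-\<delta>"] exI[of _ \<delta>]) (auto simp: u_def \<phi>_def square_def)
  next
    case (Suc k)
    then obtain a b where "a \<le> b"
      and ends: "u k a = \<delta> \<and> u k b = -\<delta> \<or> u k a = -\<delta> \<and> u k b = \<delta>"
      and inside: "\<And>t j. t \<in> {a..b} \<Longrightarrow> j \<le> k \<Longrightarrow> \<phi> j t \<in> square \<delta> (p j)"
      by auto
    have step: "\<phi> (Suc k) t = f (\<phi> k t)" for t
      by (simp add: \<phi>_def)
    have cov_k: "covers f \<delta> (p k) (p (Suc k))"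
      using cov Suc.prems by simp
    define v where "v t = fst (\<phi> k t) - fst (p k)" for t
    have \<phi>_eq: "\<phi> k t = p k + (v t, u k t)" for t
      by (simp add: v_def u_def prod_eq_iff)
    have "v t \<in> {-\<delta>..\<delta>}" if "t \<in> {a..b}" for t
      using inside[OF that order.refl] by (auto simp: v_def square_def)
    then have "v a \<in> {-\<delta>..\<delta>}" "v b \<in> {-\<delta>..\<delta>}"
      using \<open>a \<le> b\<close> by auto
    then have "u (Suc k) a > \<delta> \<and> u (Suc k) b < -\<delta> \<or> u (Suc k) a < -\<delta> \<and> u (Suc k) b > \<delta>"
      using cov_k ends \<phi>_eq[of a] \<phi>_eq[of b]
      unfolding covers_def u_def[of "Suc k"] step by metis
    from crossing_subinterval[OF \<open>a \<le> b\<close> cont_u \<open>\<delta> > 0\<close> this]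
    obtain a' b' where ab': "a \<le> a'" "a' \<le> b'" "b' \<le> b"
      and ends': "u (Suc k) a' = \<delta> \<and> u (Suc k) b' = -\<delta> \<or> u (Suc k) a' = -\<delta> \<and> u (Suc k) b' = \<delta>"
      and low: "\<And>t. t \<in> {a'..b'} \<Longrightarrow> \<bar>u (Suc k) t\<bar> \<le> \<delta>"
      by metis
    have "\<phi> j t \<in> square \<delta> (p j)" if "t \<in> {a'..b'}" "j \<le> Suc k" for j t
    proof (cases "j \<le> k")
      case True
      then show ?thesis using inside that ab' by auto
    next
      case False
      then have j: "j = Suc k" using that by simp
      have "\<phi> k t \<in> square \<delta> (p k)"
        using inside that ab' by auto
      \<comment> \<open>The piece was selected by height alone; the first clause of
        \<open>covers\<close> turns this into the horizontal bound.\<close>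
      then have "\<bar>fst (f (\<phi> k t)) - fst (p (Suc k))\<bar> < \<delta>"
        using cov_k low[OF that(1)] unfolding covers_def u_def step by blast
      then show ?thesis
        using low[OF that(1)] unfolding j u_def step square_def by simp
    qed
    with ab' ends' show ?case by blast
  qed
  \<comment> \<open>The last interval is nonempty, and each of its parameters gives a suitable
    starting point.\<close>
  from this[of m] show ?thesis
    unfolding \<phi>_def by fastforce
qed

section \<open>Connected sets, signs and squares\<close>

text \<open>A change of sign would force the value 0. The case \<open>\<delta> = 0\<close> serves to
  locate a set on one side of the axis, a positive \<open>\<delta>\<close> to compare the images of
  points on one horizontal edge.\<close>

lemma connected_abs_gt_same_sign:
  fixes u :: "'a::topological_space \<Rightarrow> real"
  assumes "connected C" "continuous_on C u" "\<delta> \<ge> 0" and gt: "\<And>x. x \<in> C \<Longrightarrow> \<bar>u x\<bar> > \<delta>"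
  shows "(\<forall>x\<in>C. u x > \<delta>) \<or> (\<forall>x\<in>C. u x < -\<delta>)"
proof (rule ccontr)
  assume "\<not> ?thesis"
  then obtain x y where xy: "x \<in> C" "y \<in> C" "u x \<le> \<delta>" "u y \<ge> -\<delta>"
    by (auto simp: not_less)
  have "u x < 0" "u y > 0"
    using gt[OF xy(1)] gt[OF xy(2)] xy(3,4) \<open>\<delta> \<ge> 0\<close> by linarith+
  moreover have "connected (u ` C)"
    using assms(1,2) by (rule connected_continuous_image[rotated])
  ultimately have "0 \<in> u ` C"
    using connectedD_interval[of "u ` C" "u x" "u y" 0] xy by auto
  then show False
    using gt \<open>\<delta> \<ge> 0\<close> by fastforce
qed

lemma compact_square: "compact (square \<delta> p)"
proof -
  have "square \<delta> p = {fst p - \<delta>..fst p + \<delta>} \<times> {snd p - \<delta>..snd p + \<delta>}"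
    by (auto simp: square_def)
  then show ?thesis
    by (simp add: compact_Times)
qed

lemma open_open_square: "open (open_square \<delta> p)"
  unfolding open_square_def by (intro open_Collect_conj open_Collect_less continuous_intros)

text \<open>Off the boundary of the square, \<open>C\<close> is covered by two disjoint open sets,
  the interior and the exterior, so it lies in one of them.\<close>

lemma connected_disjoint_square:
  assumes "connected C" and "C \<inter> (square \<delta> p - open_square \<delta> p) = {}" and "\<not> C \<subseteq> square \<delta> p"
  shows "C \<inter> square \<delta> p = {}"
proof -
  have "open (- square \<delta> p)"
    using compact_imp_closed[OF compact_square] by (simp add: open_Compl)
  moreover have "open_square \<delta> p \<subseteq> square \<delta> p"
    by (auto simp: open_square_def square_def)
  ultimately have "open_square \<delta> p \<inter> C = {} \<or> - square \<delta> p \<inter> C = {}"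
    using connectedD[OF assms(1) open_open_square, of "- square \<delta> p" \<delta> p] assms(2) by auto
  then show ?thesis
    using assms(2,3) by auto
qed

section \<open>Covering of the square around the exact image\<close>

text \<open>\<open>H\<close> controls the image of the vertical edges and \<open>edge\<close> that
  of the horizontal ones, which confines the image to the strip. \<open>pre\<close> and
  \<open>axis\<close> together exclude folding.\<close>

lemma covers_image:
  assumes homeo: "homeomorphism UNIV UNIV f (inv f)"
    and "0 < \<delta>" "\<delta> \<le> \<Delta>"
    and pre: "inv f ` square \<delta> (f p) \<subseteq> open_square \<Delta> p"
    and H: "\<And>v w. (v, w) \<in> H_set \<delta> \<Longrightarrow> \<bar>fst (f (p + (v, w))) - fst (f p)\<bar> < \<delta>"
    and axis: "\<And>v. \<bar>v\<bar> \<le> \<Delta> \<Longrightarrow> \<bar>snd (f (p + (v, 0))) - snd (f p)\<bar> < \<delta>"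
    and edge: "\<And>v w. \<bar>v\<bar> \<le> \<delta> \<Longrightarrow> \<bar>w\<bar> = \<delta> \<Longrightarrow> \<bar>snd (f (p + (v, w))) - snd (f p)\<bar> > \<delta>"
  shows "covers f \<delta> p (f p)"
proof -
  have cont: "continuous_on A f" and cont_inv: "continuous_on A (inv f)" for A
    using homeo unfolding homeomorphism_def by (auto intro: continuous_on_subset)
  have inv_f [simp]: "inv f (f q) = q" and f_inv [simp]: "f (inv f q) = q" for q
    using homeomorphism_apply1[OF homeo] homeomorphism_apply2[OF homeo] by blast+
  have coords: "q = p + (fst q - fst p, snd q - snd p)" for q
    by (simp add: prod_eq_iff)
  define u where "u v w = snd (f (p + (v, w))) - snd (f p)" for v w
  have cont_f_line: "continuous_on A (\<lambda>w. f (p + (v, w)))" "continuous_on A (\<lambda>v. f (p + (v, w)))" for A v w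
    by (rule continuous_on_compose2[OF cont]; auto intro!: continuous_intros)+
  have cont_u: "continuous_on A (u v)" "continuous_on A (\<lambda>v. u v w)" for A v w
    unfolding u_def by (intro continuous_intros cont_f_line)+

  have strip: "\<bar>fst (f q) - fst (f p)\<bar> < \<delta>"
    if q: "q \<in> square \<delta> p" and low: "\<bar>snd (f q) - snd (f p)\<bar> \<le> \<delta>" for q
  proof (rule ccontr)
    assume far: "\<not> ?thesis"
    \<comment> \<open>The sign \<open>s\<close> treats the right and the left half-strip at
      once.\<close>
    define s :: real where "s = (if fst (f q) - fst (f p) > 0 then 1 else -1)"
    have s: "s = 1 \<or> s = -1" by (simp add: s_def)
    define R where "R = {z. s * (fst z - fst (f p)) \<ge> \<delta> \<and> \<bar>snd z - snd (f p)\<bar> \<le> \<delta>}"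
    have "convex R"
    proof -
      have "R = (if s = 1 then {fst (f p) + \<delta>..} else {..fst (f p) - \<delta>}) \<times> {snd (f p) - \<delta>..snd (f p) + \<delta>}"
        using s by (auto simp: R_def)
      then show ?thesis by (auto intro!: convex_Times)
    qed
    then have "connected (inv f ` R)"
      by (intro connected_continuous_image cont_inv convex_connected)
    \<comment> \<open>Points of horizontal edges have images at the wrong height for
      \<open>R\<close>; on the remaining boundary points the horizontal offset of the image is below
      \<open>\<delta>\<close>.\<close>
    moreover have "inv f ` R \<inter> (square \<delta> p - open_square \<delta> p) = {}"
    proof (rule ccontr)
      assume "\<not> ?thesis"
      then obtain y where "inv f y \<in> square \<delta> p" "inv f y \<notin> open_square \<delta> p" "y \<in> R"
        by blast
      then obtain z where z: "z \<in> square \<delta> p" "z \<notin> open_square \<delta> p" "f z \<in> R"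
        using f_inv by metis
      define v w where "v = fst z - fst p" and "w = snd z - snd p"
      have zvw: "z = p + (v, w)" using coords v_def w_def by simp
      have bd: "\<bar>v\<bar> \<le> \<delta>" "\<bar>w\<bar> \<le> \<delta>" "\<bar>v\<bar> = \<delta> \<or> \<bar>w\<bar> = \<delta>"
        using z(1,2) by (auto simp: v_def w_def square_def open_square_def)
      show False
      proof (cases "\<bar>w\<bar> = \<delta>")
        case True
        then show False
          using edge[OF bd(1) True] z(3) by (simp add: R_def zvw)
      next
        case False
        then have "(v, w) \<in> H_set \<delta>"
          using bd by (auto simp: H_set_def)
        then have "\<bar>fst (f z) - fst (f p)\<bar> < \<delta>"
          using H zvw by blast
        then show False
          using z(3) s by (auto simp: R_def)
      qed
    qed
    moreover have "\<not> inv f ` R \<subseteq> square \<delta> p"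
    proof
      assume "inv f ` R \<subseteq> square \<delta> p"
      then have sub: "R \<subseteq> f ` square \<delta> p"
        by (metis f_inv image_eqI image_subset_iff subsetI)
      have "bounded (f ` square \<delta> p)"
        by (intro compact_imp_bounded compact_continuous_image cont compact_square)
      then obtain B where B: "\<And>z. z \<in> f ` square \<delta> p \<Longrightarrow> norm z \<le> B"
        unfolding bounded_iff by blast
      \<comment> \<open>This choice gives \<open>\<bar>x\<bar> > B\<close> wherever
        \<open>f p\<close> lies: the half-strip is unbounded, the image of the square is
        not.\<close>
      define x where "x = fst (f p) + s * (\<delta> + \<bar>B\<bar> + \<bar>fst (f p)\<bar>)"
      have "(x, snd (f p)) \<in> R"
        using s \<open>0 < \<delta>\<close> by (auto simp: R_def x_def)
      then have "norm (x, snd (f p)) \<le> B"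
        using B sub by blast
      then have "\<bar>x\<bar> \<le> B"
        using norm_fst_le[of x "snd (f p)"] by simp
      then show False
        using s \<open>0 < \<delta>\<close> unfolding x_def by (elim disjE) auto
    qed
    ultimately have "inv f ` R \<inter> square \<delta> p = {}"
      by (rule connected_disjoint_square)
    moreover have "f q \<in> R"
      using far low by (auto simp: R_def s_def)
    then have "q \<in> inv f ` R"
      by (metis imageI inv_f)
    ultimately show False
      using q by auto
  qed

  \<comment> \<open>A positive product means the same side of the horizontal axis through
    \<open>p\<close>. On a vertical edge, \<open>H\<close> forces points mapped to the level
    \<open>y\<close> into the horizontal edge \<open>T\<close> of the image square, so they lie in
    its connected preimage \<open>C\<close>.\<close>
  have one_side: "w * w' > 0"
    if "u v w = y" "u v w' = y" "\<bar>y\<bar> = \<delta>" "\<bar>v\<bar> = \<delta>" "\<bar>w\<bar> \<le> \<delta>" "\<bar>w'\<bar> \<le> \<delta>" for v w w' y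
  proof -
    define T where "T = {fst (f p) - \<delta>..fst (f p) + \<delta>} \<times> {snd (f p) + y}"
    define C where "C = inv f ` T"
    have "convex T"
      unfolding T_def by (intro convex_Times) auto
    then have "connected C"
      unfolding C_def by (intro connected_continuous_image cont_inv convex_connected)
    moreover have "\<bar>snd q - snd p\<bar> > 0" if "q \<in> C" for q
    proof -
      have "f q \<in> T" using that by (auto simp: C_def)
      have "T \<subseteq> square \<delta> (f p)"
        using \<open>\<bar>y\<bar> = \<delta>\<close> by (auto simp: T_def square_def)
      then have "q \<in> open_square \<Delta> p"
        using pre that by (auto simp: C_def)
      then have "\<bar>fst q - fst p\<bar> \<le> \<Delta>"
        by (simp add: open_square_def)
      \<comment> \<open>\<open>C\<close> may leave the square of size \<open>\<delta>\<close>, hence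
        the axis estimate up to \<open>\<Delta>\<close>. A point of \<open>C\<close> on the axis
        would have an image less than \<open>\<delta>\<close> from \<open>f p\<close> in height,
        whereas \<open>T\<close> is at distance exactly \<open>\<delta>\<close>.\<close>
      from axis[OF this] show ?thesis
        using \<open>f q \<in> T\<close> coords[of q] \<open>\<bar>y\<bar> = \<delta>\<close> by (fastforce simp: T_def)
    qed
    ultimately have "(\<forall>q\<in>C. snd q - snd p > 0) \<or> (\<forall>q\<in>C. snd q - snd p < - 0)"
      by (intro connected_abs_gt_same_sign continuous_intros) auto
    moreover have "p + (v, t) \<in> C" if "u v t = y" "\<bar>t\<bar> \<le> \<delta>" for t
    proof -
      have "(v, t) \<in> H_set \<delta>"
        using that \<open>\<bar>v\<bar> = \<delta>\<close> by (auto simp: H_set_def)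
      from H[OF this] have "f (p + (v, t)) \<in> T"
        using that by (auto simp: T_def u_def mem_Times_iff)
      then show ?thesis
        unfolding C_def by (metis imageI inv_f)
    qed
    then have "p + (v, w) \<in> C" "p + (v, w') \<in> C"
      using that by auto
    ultimately have "w > 0 \<and> w' > 0 \<or> w < 0 \<and> w' < 0"
      by fastforce
    then show ?thesis
      by (auto simp: zero_less_mult_iff)
  qed

  \<comment> \<open>The midpoint of the right edge is mapped into the band, so the intermediate
    value theorem can be used on each half of that edge.\<close>
  have "\<bar>u \<delta> 0\<bar> < \<delta>"
    using axis[of \<delta>] assms(2,3) by (simp add: u_def)
  then have mid: "u \<delta> 0 \<le> \<delta>" "-\<delta> \<le> u \<delta> 0"
    by linarith+
  have top: "\<bar>u v \<delta>\<bar> > \<delta>" and bottom: "\<bar>u v (-\<delta>)\<bar> > \<delta>" if "v \<in> {-\<delta>..\<delta>}" for v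
    using edge[of v] that \<open>0 < \<delta>\<close> by (auto simp: u_def)
  have \<delta>_mem: "\<delta> \<in> {-\<delta>..\<delta>}"
    using \<open>0 < \<delta>\<close> by simp
  \<comment> \<open>If both ends of the right edge went above, the level \<open>\<delta>\<close>
    would be attained on both halves, against \<open>one_side\<close>.\<close>
  have not_above: "\<not> (u \<delta> \<delta> > \<delta> \<and> u \<delta> (-\<delta>) > \<delta>)"
  proof
    assume ends: "u \<delta> \<delta> > \<delta> \<and> u \<delta> (-\<delta>) > \<delta>"
    obtain w where w: "0 \<le> w" "w \<le> \<delta>" "u \<delta> w = \<delta>"
      using IVT'[of "u \<delta>" 0 \<delta> \<delta>] cont_u(1) ends mid \<open>0 < \<delta>\<close> by auto
    obtain w' where w': "-\<delta> \<le> w'" "w' \<le> 0" "u \<delta> w' = \<delta>"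
      using IVT2'[of "u \<delta>" 0 \<delta> "-\<delta>"] cont_u(1) ends mid \<open>0 < \<delta>\<close> by auto
    have "w * w' > 0"
      using one_side[of \<delta> w \<delta> w'] w w' \<open>0 < \<delta>\<close> by auto
    then show False
      using w w' by (auto simp: zero_less_mult_iff)
  qed
  have not_below: "\<not> (u \<delta> \<delta> < -\<delta> \<and> u \<delta> (-\<delta>) < -\<delta>)"
  proof
    assume ends: "u \<delta> \<delta> < -\<delta> \<and> u \<delta> (-\<delta>) < -\<delta>"
    obtain w where w: "0 \<le> w" "w \<le> \<delta>" "u \<delta> w = -\<delta>"
      using IVT2'[of "u \<delta>" \<delta> "-\<delta>" 0] cont_u(1) ends mid \<open>0 < \<delta>\<close> by auto
    obtain w' where w': "-\<delta> \<le> w'" "w' \<le> 0" "u \<delta> w' = -\<delta>"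
      using IVT'[of "u \<delta>" "-\<delta>" "-\<delta>" 0] cont_u(1) ends mid \<open>0 < \<delta>\<close> by auto
    have "w * w' > 0"
      using one_side[of \<delta> w "-\<delta>" w'] w w' \<open>0 < \<delta>\<close> by auto
    then show False
      using w w' by (auto simp: zero_less_mult_iff)
  qed
  \<comment> \<open>Signs are constant along each horizontal edge, so the comparison at the right
    edge decides the orientation for all \<open>v\<close>.\<close>
  have signs: "(\<forall>v\<in>{-\<delta>..\<delta>}. u v \<delta> > \<delta>) \<or> (\<forall>v\<in>{-\<delta>..\<delta>}. u v \<delta> < -\<delta>)"
      "(\<forall>v\<in>{-\<delta>..\<delta>}. u v (-\<delta>) > \<delta>) \<or> (\<forall>v\<in>{-\<delta>..\<delta>}. u v (-\<delta>) < -\<delta>)"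
    using top bottom \<open>0 < \<delta>\<close> by (intro connected_abs_gt_same_sign cont_u(2); auto)+
  then have "(\<forall>v\<in>{-\<delta>..\<delta>}. u v \<delta> > \<delta>) \<and> (\<forall>v\<in>{-\<delta>..\<delta>}. u v (-\<delta>) < -\<delta>) \<or>
      (\<forall>v\<in>{-\<delta>..\<delta>}. u v \<delta> < -\<delta>) \<and> (\<forall>v\<in>{-\<delta>..\<delta>}. u v (-\<delta>) > \<delta>)"
    using not_above not_below \<delta>_mem by blast
  with strip show ?thesis
    unfolding covers_def u_def by blast
qed

section \<open>Stability of covering under small perturbations\<close>

text \<open>The compact set \<open>C \<times> {0}\<close> has a uniform neighbourhood inside the
  open set where \<open>\<phi>\<close> is positive. Halving its radius allows the non-strict bound
  on \<open>e\<close>.\<close>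

lemma positive_near_compact:
  fixes \<phi> :: "'a::metric_space \<times> 'b::real_normed_vector \<Rightarrow> real"
  assumes "compact C" "continuous_on UNIV \<phi>" and pos: "\<And>z. z \<in> C \<Longrightarrow> \<phi> (z, 0) > 0"
  obtains d where "d > 0" "\<And>z e. z \<in> C \<Longrightarrow> norm e \<le> d \<Longrightarrow> \<phi> (z, e) > 0"
proof -
  have "open {y. \<phi> y > 0}"
    using assms(2) by (intro open_Collect_less continuous_intros)
  moreover have "compact (C \<times> {0::'b})"
    using assms(1) by (intro compact_Times) auto
  moreover have "C \<times> {0} \<subseteq> {y. \<phi> y > 0}"
    using pos by auto
  ultimately obtain r where r: "r > 0" "(\<Union>x\<in>C \<times> {0}. ball x r) \<subseteq> {y. \<phi> y > 0}"
    using compact_subset_open_imp_ball_epsilon_subset by metis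
  have "\<phi> (z, e) > 0" if "z \<in> C" "norm e \<le> r / 2" for z e
  proof -
    have "(z, e) \<in> ball (z, 0) r"
      using that(2) \<open>r > 0\<close> by (simp add: dist_Pair_Pair dist_norm)
    then show ?thesis
      using r(2) that(1) by blast
  qed
  then show thesis
    using \<open>r > 0\<close> that[of "r / 2"] by simp
qed

text \<open>Each clause of \<open>covers\<close> becomes positivity of one continuous function, with
  the perturbation \<open>e = f p - c\<close> as a variable. Compactness then gives a
  \<open>d\<close> valid for all \<open>p\<close> in \<open>K\<close>, hence independent of the
  length of a pseudotrajectory.\<close>

lemma covers_perturbed:
  assumes "compact K" and cont: "continuous_on UNIV f"
    and cov: "\<And>p. p \<in> K \<Longrightarrow> covers f \<delta> p (f p)"
  obtains d where "d > 0" "\<And>p c. p \<in> K \<Longrightarrow> norm (f p - c) \<le> d \<Longrightarrow> covers f \<delta> p c"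
proof -
  define I where "I = {-\<delta>..\<delta>}"
  have [continuous_intros]: "continuous_on UNIV (\<lambda>x. f (t x))" if "continuous_on UNIV t"
    for t :: "((real \<times> real) \<times> real \<times> real) \<times> real \<times> real \<Rightarrow> real \<times> real"
    by (rule continuous_on_compose2[OF cont that]) auto
  \<comment> \<open>The argument is \<open>((p, q - p), e)\<close>, so \<open>z\<close> is
    \<open>f q - c\<close>. The maximum is positive iff
    \<open>\<bar>snd z\<bar> \<le> \<delta>\<close> implies
    \<open>\<bar>fst z\<bar> < \<delta>\<close>.\<close>
  define \<phi> :: "((real \<times> real) \<times> real \<times> real) \<times> real \<times> real \<Rightarrow> real" where
    "\<phi> x = (let p = fst (fst x); z = f (p + snd (fst x)) - f p + snd x
      in max (\<bar>snd z\<bar> - \<delta>) (\<delta> - \<bar>fst z\<bar>))" for x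
  have "continuous_on UNIV \<phi>"
    unfolding \<phi>_def Let_def by (intro continuous_intros)
  moreover have "\<phi> (x, 0) > 0" if "x \<in> K \<times> (I \<times> I)" for x
  proof -
    have "fst x + snd x \<in> square \<delta> (fst x)"
      using that by (auto simp: I_def square_def)
    moreover have "covers f \<delta> (fst x) (f (fst x))"
      using cov that by auto
    ultimately have "\<bar>snd (f (fst x + snd x) - f (fst x))\<bar> \<le> \<delta> \<longrightarrow>
        \<bar>fst (f (fst x + snd x) - f (fst x))\<bar> < \<delta>"
      unfolding covers_def fst_diff snd_diff by blast
    then show ?thesis
      unfolding \<phi>_def Let_def less_max_iff_disj by (auto simp: not_le)
  qed
  moreover have C: "compact (K \<times> (I \<times> I))"
    using assms(1) by (intro compact_Times) (auto simp: I_def)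
  ultimately obtain d1 where d1: "d1 > 0"
      "\<And>x e. x \<in> K \<times> (I \<times> I) \<Longrightarrow> norm e \<le> d1 \<Longrightarrow> \<phi> (x, e) > 0"
    using positive_near_compact by metis

  \<comment> \<open>The argument is \<open>((p, v, v'), e)\<close>, with \<open>t\<close> and
    \<open>b\<close> the relative heights of the images of a top and a bottom point.
    \<open>max\<close> encodes the disjunction and \<open>min\<close> the conjunctions.\<close>
  define \<psi> :: "((real \<times> real) \<times> real \<times> real) \<times> real \<times> real \<Rightarrow> real" where
    "\<psi> x = (let p = fst (fst x);
        t = snd (f (p + (fst (snd (fst x)), \<delta>)) - f p + snd x);
        b = snd (f (p + (snd (snd (fst x)), -\<delta>)) - f p + snd x)
      in max (min (t - \<delta>) (-\<delta> - b)) (min (-\<delta> - t) (b - \<delta>)))" for x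
  have "continuous_on UNIV \<psi>"
    unfolding \<psi>_def Let_def by (intro continuous_intros)
  moreover have "\<psi> (x, 0) > 0" if "x \<in> K \<times> (I \<times> I)" for x
  proof -
    obtain p v v' where x: "x = (p, v, v')"
      by (metis surj_pair)
    have "covers f \<delta> p (f p)" "v \<in> {-\<delta>..\<delta>}" "v' \<in> {-\<delta>..\<delta>}"
      using cov that by (auto simp: x I_def)
    then have "snd (f (p + (v, \<delta>)) - f p) > \<delta> \<and> snd (f (p + (v', -\<delta>)) - f p) < -\<delta> \<or>
        snd (f (p + (v, \<delta>)) - f p) < -\<delta> \<and> snd (f (p + (v', -\<delta>)) - f p) > \<delta>"
      unfolding covers_def snd_diff by blast
    then show ?thesis
      by (auto simp: x \<psi>_def Let_def less_max_iff_disj)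
  qed
  ultimately obtain d2 where d2: "d2 > 0"
      "\<And>x e. x \<in> K \<times> (I \<times> I) \<Longrightarrow> norm e \<le> d2 \<Longrightarrow> \<psi> (x, e) > 0"
    using positive_near_compact[OF C] by metis

  have "covers f \<delta> p c" if p: "p \<in> K" and c: "norm (f p - c) \<le> min d1 d2" for p c
    unfolding covers_def
  proof (intro conjI ballI impI)
    fix q assume "q \<in> square \<delta> p" and low: "\<bar>snd (f q) - snd c\<bar> \<le> \<delta>"
    then have "q - p \<in> I \<times> I"
      by (auto simp: square_def I_def mem_Times_iff)
    with p c d1(2)[of "(p, q - p)" "f p - c"] have "\<phi> ((p, q - p), f p - c) > 0"
      by auto
    then show "\<bar>fst (f q) - fst c\<bar> < \<delta>"
      using low by (auto simp: \<phi>_def Let_def less_max_iff_disj)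
  next
    fix v v' assume "v \<in> {-\<delta>..\<delta>}" "v' \<in> {-\<delta>..\<delta>}"
    with p c d2(2)[of "(p, v, v')" "f p - c"] have "\<psi> ((p, v, v'), f p - c) > 0"
      by (auto simp: I_def)
    then show "snd (f (p + (v, \<delta>))) - snd c > \<delta> \<and> snd (f (p + (v', -\<delta>))) - snd c < -\<delta> \<or>
      snd (f (p + (v, \<delta>))) - snd c < -\<delta> \<and> snd (f (p + (v', -\<delta>))) - snd c > \<delta>"
      by (auto simp: \<psi>_def Let_def less_max_iff_disj)
  qed
  then show thesis
    using d1(1) d2(1) that[of "min d1 d2"] by simp
qed

section \<open>From covering squares to Euclidean shadowing\<close>

theorem theorem4p1:
  fixes f :: "real \<times> real \<Rightarrow> real \<times> real"
    and g h :: "real \<Rightarrow> real \<Rightarrow> real"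
    and K :: "(real \<times> real) set"
  assumes f_eq: "\<And>x y. f (x, y) = (g x y, h x y)"
    and homeo: "homeomorphism UNIV UNIV f (inv f)"
    and fixed_origin: "f (0, 0) = (0, 0)"
    and compact_K: "compact K"
    and conditions: "\<And>\<Delta>\<^sub>0::real. \<Delta>\<^sub>0 > 0 \<Longrightarrow>
      \<exists>\<delta> \<Delta>. 0 < \<delta> \<and> \<delta> < \<Delta> \<and> \<Delta> < \<Delta>\<^sub>0 \<and>
        (\<forall>px py. (px, py) \<in> K \<longrightarrow>
          (f ` square \<delta> (px, py) \<subseteq> open_square \<Delta> (f (px, py)) \<and>
           inv f ` square \<delta> (f (px, py)) \<subseteq> open_square \<Delta> (px, py)) \<and>
          (\<forall>(v, w) \<in> H_set \<delta>. \<bar>g (px + v) (py + w) - g px py\<bar> < \<delta>) \<and>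
          (\<forall>v. \<bar>v\<bar> \<le> \<Delta> \<longrightarrow> \<bar>h (px + v) py - h px py\<bar> < \<delta>) \<and>
          (\<forall>v w. \<bar>v\<bar> \<le> \<delta> \<and> \<bar>w\<bar> = \<delta> \<longrightarrow> \<bar>h (px + v) (py + w) - h px py\<bar> > \<delta>))"
  shows "finite_shadowing f K"
proof -
  have cont: "continuous_on UNIV f"
    using homeo by (simp add: homeomorphism_def)
  have "\<exists>d>0. \<forall>m p. finite_pseudotrajectory f d m p \<and> (\<forall>k\<le>m. p k \<in> K) \<longrightarrow>
      (\<exists>r. \<forall>k\<le>m. norm ((f ^^ k) r - p k) \<le> \<epsilon>)" if "\<epsilon> > 0" for \<epsilon>
  proof -
    \<comment> \<open>The Euclidean norm is at most the sum of the two coordinate distances, that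
      is, at most \<open>2 * \<delta>\<close> on a square.\<close>
    have "\<epsilon> / 2 > 0"
      using that by simp
    from conditions[OF this] obtain \<delta> \<Delta> where \<delta>: "0 < \<delta>" "\<delta> < \<Delta>" "\<Delta> < \<epsilon> / 2"
      and cond: "\<And>px py. (px, py) \<in> K \<Longrightarrow>
          (f ` square \<delta> (px, py) \<subseteq> open_square \<Delta> (f (px, py)) \<and>
           inv f ` square \<delta> (f (px, py)) \<subseteq> open_square \<Delta> (px, py)) \<and>
          (\<forall>(v, w) \<in> H_set \<delta>. \<bar>g (px + v) (py + w) - g px py\<bar> < \<delta>) \<and>
          (\<forall>v. \<bar>v\<bar> \<le> \<Delta> \<longrightarrow> \<bar>h (px + v) py - h px py\<bar> < \<delta>) \<and>
          (\<forall>v w. \<bar>v\<bar> \<le> \<delta> \<and> \<bar>w\<bar> = \<delta> \<longrightarrow> \<bar>h (px + v) (py + w) - h px py\<bar> > \<delta>)"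
      by metis
    have "covers f \<delta> p (f p)" if "p \<in> K" for p
    proof -
      obtain px py where p: "p = (px, py)" by fastforce
      note c = cond[OF that[unfolded p]]
      show ?thesis
        unfolding p
      proof (rule covers_image[OF homeo, of \<delta> \<Delta>])
        show "inv f ` square \<delta> (f (px, py)) \<subseteq> open_square \<Delta> (px, py)"
          using c by blast
      qed (use c \<delta> in \<open>auto simp: f_eq\<close>)
    qed
    from covers_perturbed[OF compact_K cont this]
    obtain d where "d > 0" and d: "\<And>p c. p \<in> K \<Longrightarrow> norm (f p - c) \<le> d \<Longrightarrow> covers f \<delta> p c"
      by metis
    have "\<exists>r. \<forall>k\<le>m. norm ((f ^^ k) r - p k) \<le> \<epsilon>"
      if "finite_pseudotrajectory f d m p" "\<forall>k\<le>m. p k \<in> K" for m p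
    proof -
      \<comment> \<open>The next point of the pseudotrajectory is the perturbed centre
        \<open>c\<close>.\<close>
      have "covers f \<delta> (p k) (p (Suc k))" if "k < m" for k
        using d that \<open>finite_pseudotrajectory f d m p\<close> \<open>\<forall>k\<le>m. p k \<in> K\<close>
        by (simp add: finite_pseudotrajectory_def)
      from orbit_through_squares[where m = m and p = p, OF \<delta>(1) cont this]
      obtain r where r: "\<And>k. k \<le> m \<Longrightarrow> (f ^^ k) r \<in> square \<delta> (p k)"
        by blast
      have "norm (q - c) \<le> \<epsilon>" if "q \<in> square \<delta> c" for q c
      proof -
        have "norm (q - c) \<le> \<bar>fst (q - c)\<bar> + \<bar>snd (q - c)\<bar>"
          unfolding norm_prod_def real_norm_def power2_abs by (rule sqrt_sum_squares_le_sum_abs)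
        also have "\<dots> \<le> \<epsilon>"
          using that \<delta> by (simp add: square_def)
        finally show ?thesis .
      qed
      with r show ?thesis by blast
    qed
    with \<open>d > 0\<close> show ?thesis by blast
  qed
  then show ?thesis
    by (simp add: finite_shadowing_def)
qed

end
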